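(* Let $G\cong \mathrm{PSL}(2,q)$ with $q$ even (i.e. $q$ a power of $2$, $q\geq 2$). Then $\Gamma_S(G)$ is a cograph if and only if $q=2$.
   Context: For a group $G$ with identity $e$, the intersection subgroup graph $\Gamma_S(G)$ is the simple graph whose vertices are the non-trivial subgroups $H$ of $G$ such that $H\cap K=\{e\}$ for some non-trivial subgroup $K$ of $G$; two distinct vertices $H,K$ are adjacent if and only if $H\cap K=\{e\}$. A graph is a cograph if it has no induced subgraph isomorphic to the path $P_4$ on four vertices. *)

theory Defs
  imports
    "HOL-Analysis.Determinants"
    "HOL-Algebra.Coset"
    "Graph_Theory.Digraph_Component"
    "Graph_Theory.Digraph_Isomorphism"
begin

section \<open>Projective special linear groups\<close>

definition center :: "('a, 'm) monoid_scheme \<Rightarrow> 'a set" where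
  "center G = {z \<in> carrier G. \<forall>g \<in> carrier G. z \<otimes>\<^bsub>G\<^esub> g = g \<otimes>\<^bsub>G\<^esub> z}"

lemma (in group) center_normal: "center G \<lhd> G"
proof -
  have inv: "inv z \<in> center G" if z: "z \<in> center G" for z
  proof -
    have zc: "z \<in> carrier G" using z by (simp add: center_def)
    have "inv z \<otimes> g = g \<otimes> inv z" if g: "g \<in> carrier G" for g
    proof -
      have "z \<otimes> inv g = inv g \<otimes> z" using z g by (simp add: center_def)
      hence "inv (z \<otimes> inv g) = inv (inv g \<otimes> z)" by simp
      thus ?thesis using zc g by (simp add: inv_mult_group)
    qed
    thus ?thesis using zc by (simp add: center_def)
  qed
  have mult: "x \<otimes> y \<in> center G" if x: "x \<in> center G" and y: "y \<in> center G" for x y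
  proof -
    have xc: "x \<in> carrier G" and yc: "y \<in> carrier G" using x y by (simp_all add: center_def)
    have "(x \<otimes> y) \<otimes> g = g \<otimes> (x \<otimes> y)" if g: "g \<in> carrier G" for g
    proof -
      have "(x \<otimes> y) \<otimes> g = x \<otimes> (g \<otimes> y)" using xc y g by (simp add: center_def m_assoc)
      also have "\<dots> = (x \<otimes> g) \<otimes> y" using xc yc g by (simp add: m_assoc)
      also have "\<dots> = g \<otimes> (x \<otimes> y)" using x yc g by (simp add: center_def m_assoc)
      finally show ?thesis .
    qed
    thus ?thesis using xc yc by (simp add: center_def)
  qed
  have sub: "subgroup (center G) G"
  proof (rule subgroupI)
    show "center G \<subseteq> carrier G" by (auto simp: center_def)
    have "\<one> \<in> center G" by (simp add: center_def)
    thus "center G \<noteq> {}" by blast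
  qed (use inv mult in blast)+
  have "g \<otimes> z \<otimes> inv g \<in> center G" if g: "g \<in> carrier G" and z: "z \<in> center G" for g z
  proof -
    have zc: "z \<in> carrier G" using z by (simp add: center_def)
    have "g \<otimes> z = z \<otimes> g" using z g by (simp add: center_def)
    hence "g \<otimes> z \<otimes> inv g = z" using g zc by (simp add: m_assoc)
    thus ?thesis using z by simp
  qed
  thus ?thesis using sub by (simp add: normal_inv_iff)
qed

text \<open>The degree is \<^term>\<open>CARD('n)\<close> and the field of coefficients is the type \<open>'f\<close>.\<close>

definition SL :: "('f::field ^ 'n ^ 'n) monoid" where
  "SL = \<lparr>carrier = {A. det A = 1}, mult = (**), one = mat 1\<rparr>"

definition PSL :: "('f::field ^ 'n ^ 'n) set monoid" where
  "PSL = SL Mod center SL"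

lemma group_SL: "group (SL :: ('f::field ^ 'n ^ 'n) monoid)"
proof (rule groupI)
  fix A :: "'f ^ 'n ^ 'n"
  assume "A \<in> carrier SL"
  hence dA: "det A = 1" by (simp add: SL_def)
  hence "invertible A" by (simp add: invertible_det_nz)
  then obtain B where B: "B ** A = mat 1" by (auto simp: invertible_def)
  have "det B * det A = 1" using B by (metis det_mul det_I)
  hence "det B = 1" using dA by simp
  thus "\<exists>B \<in> carrier SL. B \<otimes>\<^bsub>SL\<^esub> A = \<one>\<^bsub>SL\<^esub>"
    using B by (auto simp: SL_def)
qed (auto simp: SL_def det_mul matrix_mul_assoc)

lemma group_PSL: "group (PSL :: ('f::field ^ 'n ^ 'n) set monoid)"
  unfolding PSL_def
  by (rule normal.factorgroup_is_group, rule group.center_normal, rule group_SL)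


section \<open>Intersection subgroup graphs and cographs\<close>

text \<open>
  As usual in \<open>Graph_Theory\<close>, a simple graph is a loop-free symmetric digraph without parallel
  arcs; an undirected edge is a pair of opposite arcs.
\<close>

definition nontrivial_subgroup :: "'a set \<Rightarrow> ('a, 'm) monoid_scheme \<Rightarrow> bool" where
  "nontrivial_subgroup H G \<longleftrightarrow> subgroup H G \<and> H \<noteq> {\<one>\<^bsub>G\<^esub>}"

definition intersection_subgroup_verts :: "('a, 'm) monoid_scheme \<Rightarrow> 'a set set" where
  "intersection_subgroup_verts G =
    {H. nontrivial_subgroup H G \<and>
        (\<exists>K. nontrivial_subgroup K G \<and> H \<inter> K = {\<one>\<^bsub>G\<^esub>})}"

definition intersection_subgroup_graph :: "('a, 'm) monoid_scheme \<Rightarrow> 'a set pair_pre_digraph" where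
  "intersection_subgroup_graph G =
    \<lparr>pverts = intersection_subgroup_verts G,
     parcs = {(H, K). H \<in> intersection_subgroup_verts G \<and> K \<in> intersection_subgroup_verts G \<and>
                      H \<noteq> K \<and> H \<inter> K = {\<one>\<^bsub>G\<^esub>}}\<rparr>"

definition path_graph :: "nat \<Rightarrow> nat pair_pre_digraph" where
  "path_graph n = \<lparr>pverts = {..<n},
     parcs = {(i, j). i < n \<and> j < n \<and> (j = Suc i \<or> i = Suc j)}\<rparr>"

definition cograph :: "('v, 'e) pre_digraph \<Rightarrow> bool" where
  "cograph \<Gamma> \<longleftrightarrow>
     \<not> (\<exists>H. induced_subgraph H \<Gamma> \<and> digraph_iso H (with_proj (path_graph 4)))"

text \<open>
  The predicate \<^const>\<open>induced_subgraph\<close> requires well-formedness of the ambient graph, so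
  \<^const>\<open>cograph\<close> is only meaningful for well-formed graphs. The following facts show that
  this is the case for intersection subgroup graphs.
\<close>

lemma intersection_subgroup_graph_simple:
  fixes G (structure)
  shows "loopfree_digraph (with_proj (intersection_subgroup_graph G))"
    and "nomulti_digraph (with_proj (intersection_subgroup_graph G))"
    and "sym_digraph (with_proj (intersection_subgroup_graph G))"
proof -
  let ?\<Gamma> = "with_proj (intersection_subgroup_graph G)"
  have wf: "wf_digraph ?\<Gamma>"
    by (rule wf_digraph.intro; clarsimp simp: intersection_subgroup_graph_def with_proj_def)
  have noloop: "tail ?\<Gamma> e \<noteq> head ?\<Gamma> e" if "e \<in> arcs ?\<Gamma>" for e
    using that by (auto simp: intersection_subgroup_graph_def with_proj_def)
  show "loopfree_digraph ?\<Gamma>"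
    using wf noloop by (simp add: loopfree_digraph_def loopfree_digraph_axioms_def)
  have "e1 = e2" if "arc_to_ends ?\<Gamma> e1 = arc_to_ends ?\<Gamma> e2" for e1 e2
    using that by (simp add: arc_to_ends_def with_proj_def prod_eq_iff)
  thus "nomulti_digraph ?\<Gamma>"
    using wf by (simp add: nomulti_digraph_def nomulti_digraph_axioms_def)
  have "arcs_ends ?\<Gamma> = parcs (intersection_subgroup_graph G)"
    by (simp add: arcs_ends_conv with_proj_def)
  moreover have "sym (parcs (intersection_subgroup_graph G))"
    unfolding intersection_subgroup_graph_def by (rule symI) (auto simp: Int_commute)
  ultimately have "symmetric ?\<Gamma>" by (simp add: symmetric_def)
  thus "sym_digraph ?\<Gamma>"
    using wf by (simp add: sym_digraph_def sym_digraph_axioms_def)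
qed

lemma intersection_subgroup_graph_graph:
  assumes "finite (carrier G)"
  shows "graph (with_proj (intersection_subgroup_graph G))"
proof -
  let ?\<Gamma> = "with_proj (intersection_subgroup_graph G)"
  interpret loopfree_digraph ?\<Gamma> by (rule intersection_subgroup_graph_simple)
  interpret nomulti_digraph ?\<Gamma> by (rule intersection_subgroup_graph_simple)
  interpret sym_digraph ?\<Gamma> by (rule intersection_subgroup_graph_simple)
  have "verts ?\<Gamma> \<subseteq> Pow (carrier G)"
    unfolding intersection_subgroup_graph_def with_proj_def intersection_subgroup_verts_def
      nontrivial_subgroup_def
    using subgroup.subset by fastforce
  hence V: "finite (verts ?\<Gamma>)" by (rule finite_subset) (simp add: assms)
  have "arcs ?\<Gamma> \<subseteq> verts ?\<Gamma> \<times> verts ?\<Gamma>"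
    by (auto simp: intersection_subgroup_graph_def with_proj_def)
  hence "finite (arcs ?\<Gamma>)" by (rule finite_subset) (rule finite_cartesian_product[OF V V])
  with V show ?thesis by unfold_locales simp_all
qed

end

theory Submission
  imports Defs "HOL-Library.Z2" "HOL-Library.Disjoint_Sets" "HOL-Computational_Algebra.Primes"
begin

text \<open>
  For \<open>q = 2\<close> the group has at most six elements, so its proper non-trivial subgroups have prime
  order and any two distinct ones meet trivially: the graph is complete.

  For \<open>q > 2\<close> the field has characteristic 2, hence the centre of \<open>SL(2,q)\<close> is trivial and
  \<open>G \<cong> SL(2,q)\<close>. Let \<open>U\<close> and \<open>L\<close> be the groups of upper and lower unitriangular matrices, let
  \<open>X\<close> be the group of order 2 generated by an upper unitriangular matrix whose corner entry is
  neither 0 nor 1, and let \<open>S = SL(2,2)\<close> be the subgroup of matrices over the prime field. Then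
  \<open>U - L - X - S\<close> is an induced path: \<open>X \<subseteq> U\<close>, and \<open>S\<close> contains an element of \<open>U\<close> and one of \<open>L\<close>.
\<close>

section \<open>Induced paths and complete graphs\<close>

lemma arcs_induce_subgraph_with_proj:
  "arcs (with_proj P \<restriction> V) = parcs P \<inter> V \<times> V"
  by (auto simp: induce_subgraph_def)

text \<open>Numbering the four vertices along the path gives an isomorphism from the subgraph they
  induce onto \<open>path_graph 4\<close>.\<close>

lemma not_cograph_path:
  assumes wf: "wf_digraph (with_proj P)"
    and V: "{a, b, c, d} \<subseteq> pverts P"
    and dist: "distinct [a, b, c, d]"
    and arcs: "parcs P \<inter> {a, b, c, d} \<times> {a, b, c, d} =
      {(a, b), (b, a), (b, c), (c, b), (c, d), (d, c)}"
  shows "\<not> cograph (with_proj P)"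
proof -
  let ?V = "{a, b, c, d}"
  let ?H = "with_proj P \<restriction> ?V"
  define g :: "_ \<Rightarrow> nat" where "g v = (if v = a then 0 else if v = b then 1 else if v = c then 2 else 3)" for v
  have g: "g a = 0" "g b = 1" "g c = 2" "g d = 3"
    using dist by (auto simp: g_def)
  have inj: "inj_on g ?V"
    using g by (auto simp: inj_on_def)
  have H: "verts ?H = ?V" "tail ?H = fst" "head ?H = snd"
    by (simp_all add: induce_subgraph_def)
  have arcsH: "arcs ?H = {(a, b), (b, a), (b, c), (c, b), (c, d), (d, c)}"
    using arcs by (simp only: arcs_induce_subgraph_with_proj)
  have ind: "induced_subgraph ?H (with_proj P)"
    using V by (intro wf_digraph.induced_induce[OF wf]) simp
  hence wfH: "wf_digraph ?H"
    by (simp only: induced_subgraph_def subgraph_def)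
  have "digraph_iso ?H (with_proj (path_graph 4))"
  proof -
    \<comment> \<open>Arcs are ordered pairs of vertices, so the map on arcs is forced: apply
      \<open>g\<close> to both ends.\<close>
    let ?f = "\<lparr>iso_verts = g, iso_arcs = map_prod g g, iso_head = snd, iso_tail = fst\<rparr>"
    have "arcs ?H \<subseteq> ?V \<times> ?V"
      by (simp only: arcs_induce_subgraph_with_proj Int_lower2)
    with map_prod_inj_on[OF inj inj] have "inj_on (map_prod g g) (arcs ?H)"
      by (rule inj_on_subset)
    hence iso: "pre_digraph.digraph_isomorphism ?H ?f"
      using wfH inj by (simp add: pre_digraph.digraph_isomorphism_def H)
    have "{..<4} = {0, 1, 2, 3::nat}"
      by auto
    moreover have "{(i, j). i < 4 \<and> j < 4 \<and> (j = Suc i \<or> i = Suc j)} =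
        {(0, 1), (1, 0), (1, 2), (2, 1), (2, 3), (3, 2)}"
      by auto
    ultimately have "with_proj (path_graph 4) = app_iso ?f ?H"
      unfolding app_iso_def arcsH H
      by (simp add: with_proj_def path_graph_def g)
    with iso show ?thesis
      unfolding digraph_iso_def by blast
  qed
  with ind show ?thesis
    unfolding cograph_def by blast
qed

text \<open>An induced copy of the path would contain two distinct vertices corresponding to 0 and
  2. Completeness joins them, but 0 and 2 are not adjacent in the path.\<close>

lemma cograph_complete:
  assumes complete: "\<And>u v. u \<in> pverts P \<Longrightarrow> v \<in> pverts P \<Longrightarrow> u \<noteq> v \<Longrightarrow> (u, v) \<in> parcs P"
  shows "cograph (with_proj P)"
  unfolding cograph_def
proof clarify
  fix H assume ind: "induced_subgraph H (with_proj P)"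
    and "digraph_iso H (with_proj (path_graph 4))"
  then obtain f where f: "pre_digraph.digraph_isomorphism H f"
    and eq: "with_proj (path_graph 4) = app_iso f H"
    unfolding digraph_iso_def by blast
  have "iso_verts f ` verts H = {..<4}"
    using arg_cong[OF eq, of verts] by (simp add: path_graph_def)
  hence "0 \<in> iso_verts f ` verts H" "2 \<in> iso_verts f ` verts H"
    by simp_all
  then obtain u v where u: "u \<in> verts H" "iso_verts f u = 0"
    and v: "v \<in> verts H" "iso_verts f v = 2"
    by (metis imageE)
  from u v have "u \<noteq> v" by auto
  with u v ind complete have uv: "(u, v) \<in> arcs H"
    by (auto simp: induced_subgraph_def subgraph_def)
  have "tail H = fst" "head H = snd"
    using ind by (auto simp: induced_subgraph_def subgraph_def compatible_def)
  hence ends: "tail H (u, v) = u" "head H (u, v) = v"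
    by simp_all
  let ?e = "iso_arcs f (u, v)"
  have "?e \<in> arcs (with_proj (path_graph 4))"
    unfolding eq arcs_app_iso using uv by (rule imageI)
  moreover have "tail (with_proj (path_graph 4)) ?e = 0" "head (with_proj (path_graph 4)) ?e = 2"
    using pre_digraph.iso_verts_tail[OF f uv] pre_digraph.iso_verts_head[OF f uv] u(2) v(2)
    unfolding eq tail_app_iso head_app_iso ends by simp_all
  ultimately show False
    by (auto simp: path_graph_def)
qed

section \<open>Intersection subgroup graphs\<close>

lemma nontrivial_subgroup_iso_image:
  assumes "group G" "group K" "h \<in> iso G K" "nontrivial_subgroup H G"
  shows "nontrivial_subgroup (h ` H) K"
proof -
  have sub: "subgroup H G" and "H \<noteq> {\<one>\<^bsub>G\<^esub>}"
    using assms(4) by (auto simp: nontrivial_subgroup_def)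
  have "h ` H \<noteq> h ` {\<one>\<^bsub>G\<^esub>}"
    using assms(1,3) sub \<open>H \<noteq> {\<one>\<^bsub>G\<^esub>}\<close>
    by (subst inj_on_image_eq_iff[of h "carrier G"])
      (auto simp: iso_iff subgroup.subset group.is_monoid dest: subgroup.subset)
  moreover have "h \<one>\<^bsub>G\<^esub> = \<one>\<^bsub>K\<^esub>"
    using assms(1-3) by (auto simp: iso_def intro: hom_one)
  ultimately show ?thesis
    using subgroup.iso_subgroup[OF sub assms(1-3)] by (simp add: nontrivial_subgroup_def)
qed

text \<open>The six conditions on intersections say exactly that \<open>A\<close>, \<open>B\<close>,
  \<open>C\<close>, \<open>D\<close> in this order form an induced path.\<close>

lemma (in group) not_cograph_intersection_subgroup_graph:
  assumes "nontrivial_subgroup A G" "nontrivial_subgroup B G"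
    and "nontrivial_subgroup C G" "nontrivial_subgroup D G"
    and "A \<inter> B = {\<one>}" "B \<inter> C = {\<one>}" "C \<inter> D = {\<one>}"
    and "A \<inter> C \<noteq> {\<one>}" "A \<inter> D \<noteq> {\<one>}" "B \<inter> D \<noteq> {\<one>}"
  shows "\<not> cograph (with_proj (intersection_subgroup_graph G))"
proof (rule not_cograph_path[of _ A B C D])
  show "wf_digraph (with_proj (intersection_subgroup_graph G))"
    by (rule loopfree_digraph.axioms(1)) (rule intersection_subgroup_graph_simple)
  have nontriv: "A \<noteq> {\<one>}" "B \<noteq> {\<one>}" "C \<noteq> {\<one>}" "D \<noteq> {\<one>}"
    using assms(1-4) by (simp_all add: nontrivial_subgroup_def)
  have "A \<noteq> B" "B \<noteq> C" "C \<noteq> D"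
    using nontriv assms(5-7) by (metis Int_absorb)+
  \<comment> \<open>In each of these pairs the two subgroups are told apart by a third one that
    meets only one of them trivially.\<close>
  moreover have "A \<noteq> C" "A \<noteq> D" "B \<noteq> D"
    using assms(5-10) by (metis Int_commute)+
  ultimately show dist: "distinct [A, B, C, D]"
    by simp
  let ?V = "intersection_subgroup_verts G"
  \<comment> \<open>A neighbour on the path is the witness that each of the four is a
    vertex.\<close>
  have V: "A \<in> ?V" "B \<in> ?V" "C \<in> ?V" "D \<in> ?V"
    unfolding intersection_subgroup_verts_def using assms(1-7) by blast+
  thus "{A, B, C, D} \<subseteq> pverts (intersection_subgroup_graph G)"
    by (simp add: intersection_subgroup_graph_def)
  let ?E = "parcs (intersection_subgroup_graph G)"
  have E: "(H, K) \<in> ?E \<longleftrightarrow> H \<noteq> K \<and> H \<inter> K = {\<one>}" if "H \<in> ?V" "K \<in> ?V" for H K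
    using that by (simp add: intersection_subgroup_graph_def)
  have flip: "B \<inter> A = {\<one>}" "C \<inter> B = {\<one>}" "D \<inter> C = {\<one>}"
    "C \<inter> A \<noteq> {\<one>}" "D \<inter> A \<noteq> {\<one>}" "D \<inter> B \<noteq> {\<one>}"
    using assms(5-10) by (metis Int_commute)+
  show "?E \<inter> {A, B, C, D} \<times> {A, B, C, D} = {(A, B), (B, A), (B, C), (C, B), (C, D), (D, C)}"
    (is "?L = ?R")
  proof
    show "?L \<subseteq> ?R"
    proof (rule subrelI)
      have all: "\<forall>H\<in>{A, B, C, D}. \<forall>K\<in>{A, B, C, D}. (H, K) \<in> ?E \<longrightarrow> (H, K) \<in> ?R"
        using assms(8-10) flip(4-6) by (simp add: E V)
      fix H K assume "(H, K) \<in> ?L"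
      hence "H \<in> {A, B, C, D}" "K \<in> {A, B, C, D}" "(H, K) \<in> ?E"
        by (simp_all only: Int_iff mem_Sigma_iff)
      thus "(H, K) \<in> ?R"
        by (rule all[THEN bspec, THEN bspec, THEN mp])
    qed
    show "?R \<subseteq> ?L"
      using dist assms(5-7) flip(1-3) by (simp add: E V) metis
  qed
qed

section \<open>Groups of order at most six\<close>

text \<open>By Lagrange the index of \<open>H\<close> is at least 2, so \<open>H\<close> has at most
  three elements.\<close>

lemma (in group) prime_card_proper_subgroup:
  assumes "subgroup H G" "finite (carrier G)" "order G \<le> 6" "H \<noteq> {\<one>}" "H \<noteq> carrier G"
  shows "prime (card H)"
proof -
  have "card H dvd order G"
    using lagrange[OF assms(1)] by (metis dvd_triv_right)
  moreover have "card H < order G"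
    unfolding order_def using assms subgroup.subset by (metis psubset_card_mono psubsetI)
  moreover have "card H > 1"
    using assms(1,2,4) by (metis card_1_singletonE less_one linorder_neqE_nat singletonD
        subgroup.finite_imp_card_positive subgroup.one_closed not_less_zero)
  ultimately obtain k where k: "order G = card H * k" "1 < k" "1 < card H"
    by (metis dvdE less_irrefl_nat less_one linorder_neqE_nat mult_0_right mult_1_right not_less_zero)
  hence "card H * 2 \<le> card H * k" by simp
  with k assms(3) have "card H = 2 \<or> card H = 3" by linarith
  thus ?thesis by (auto simp: prime_nat_numeral_eq)
qed

lemma (in group) cograph_intersection_subgroup_graph_small:
  assumes fin: "finite (carrier G)" and ord: "order G \<le> 6"
  shows "cograph (with_proj (intersection_subgroup_graph G))"
proof (rule cograph_complete)
  fix H K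
  assume "H \<in> pverts (intersection_subgroup_graph G)" "K \<in> pverts (intersection_subgroup_graph G)"
    and ne: "H \<noteq> K"
  hence V: "H \<in> intersection_subgroup_verts G" "K \<in> intersection_subgroup_verts G"
    by (simp_all add: intersection_subgroup_graph_def)
  have prime: "prime (card A)" if A: "A \<in> intersection_subgroup_verts G" for A
  proof -
    from A obtain B where "subgroup A G" "A \<noteq> {\<one>}" "subgroup B G" "B \<noteq> {\<one>}" "A \<inter> B = {\<one>}"
      by (auto simp: intersection_subgroup_verts_def nontrivial_subgroup_def)
    \<comment> \<open>The whole group would contain \<open>B\<close> and so meet it in
      \<open>B\<close>, which is non-trivial.\<close>
    moreover from this have "A \<noteq> carrier G"
      using subgroup.subset by fastforce
    ultimately show ?thesis
      using prime_card_proper_subgroup fin ord by blast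
  qed
  have sub: "subgroup A G" "finite A" if A: "A \<in> intersection_subgroup_verts G" for A
    using A fin subgroup.finite_imp_card_positive card_gt_0_iff
    by (auto simp: intersection_subgroup_verts_def nontrivial_subgroup_def)
  have "A \<inter> B = A" if A: "A \<in> intersection_subgroup_verts G" and B: "B \<in> intersection_subgroup_verts G"
    and I: "A \<inter> B \<noteq> {\<one>}" for A B
  proof -
    have AB: "subgroup (A \<inter> B) G"
      using A B by (simp add: sub subgroups_Inter_pair)
    \<comment> \<open>Lagrange is applied inside \<open>A\<close>, taken as a group in its own
      right, whose order is prime.\<close>
    have "group (G\<lparr>carrier := A\<rparr>)" "subgroup (A \<inter> B) (G\<lparr>carrier := A\<rparr>)"
      using A AB sub(1) by (auto intro: subgroup_imp_group subgroup_incl)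
    from group.lagrange[OF this] have "card (A \<inter> B) dvd card A"
      by (simp add: order_def dvd_def mult.commute) (metis mult.commute)
    moreover have "card (A \<inter> B) \<noteq> 1"
      using I AB by (metis card_1_singletonE singletonD subgroup.one_closed)
    ultimately have "card (A \<inter> B) = card A"
      using prime[OF A] by (auto simp: prime_nat_iff)
    thus ?thesis
      using sub(2)[OF A] by (simp add: card_subset_eq)
  qed
  \<comment> \<open>Otherwise the previous fact, used in both orders, yields
    \<open>H = H \<inter> K = K\<close>.\<close>
  with V ne have "H \<inter> K = {\<one>}"
    by (metis Int_commute)
  with V ne show "(H, K) \<in> parcs (intersection_subgroup_graph G)"
    by (simp add: intersection_subgroup_graph_def)
qed

section \<open>The special linear group of degree two\<close>

text \<open>If 1 + 1 were not 0, negation would pair off the non-zero elements without fixed points.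
  Their number would then be even, but it is one less than an even number.\<close>

lemma even_card_imp_char_2:
  assumes "even CARD('f::{field,finite})"
  shows "(1::'f) + 1 = 0"
proof (rule ccontr)
  assume two: "(1::'f) + 1 \<noteq> 0"
  \<comment> \<open>Summing ones in the field \<open>bit\<close> counts modulo 2.\<close>
  have "(\<Sum>x\<in>UNIV - {0::'f}. 1::bit) = 0"
  proof (rule sum_involution_eq_0[where h = uminus])
    fix x :: 'f assume "x \<in> UNIV - {0}"
    hence "(1 + 1) * x \<noteq> 0" using two by simp
    hence "x + x \<noteq> 0" by (simp add: distrib_right)
    thus "- x \<noteq> x" by (metis add.right_inverse)
  qed auto
  hence "of_nat CARD('f) = (1::bit)"
    by (simp add: card_Diff_singleton)
  moreover have "of_nat CARD('f) = (0::bit)"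
    using assms by (elim evenE) (simp only: of_nat_mult of_nat_numeral bit_2_eq_0 mult_zero_left)
  ultimately show False by simp
qed

section \<open>Matrices of size two given by their entries\<close>

definition mat2 :: "'a \<Rightarrow> 'a \<Rightarrow> 'a \<Rightarrow> 'a::zero \<Rightarrow> 'a ^ 2 ^ 2" where
  "mat2 a b c d = vector [vector [a, b], vector [c, d]]"

lemma mat2_nth [simp]:
  "mat2 a b c d $ 1 $ 1 = a" "mat2 a b c d $ 1 $ 2 = b"
  "mat2 a b c d $ 2 $ 1 = c" "mat2 a b c d $ 2 $ 2 = d"
  by (simp_all add: mat2_def)

lemma mat2_eq_iff [simp]:
  "mat2 a b c d = mat2 a' b' c' d' \<longleftrightarrow> a = a' \<and> b = b' \<and> c = c' \<and> d = d'"
  by (metis mat2_nth)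

lemma mat2_cases: obtains a b c d where "A = mat2 a b c d"
proof
  show "A = mat2 (A $ 1 $ 1) (A $ 1 $ 2) (A $ 2 $ 1) (A $ 2 $ 2)"
    by (simp add: vec_eq_iff forall_2)
qed

lemma mat_1_mat2: "(mat 1 :: 'a::{zero,one} ^ 2 ^ 2) = mat2 1 0 0 1"
  by (simp add: vec_eq_iff forall_2 mat_def)

lemma mat2_mult [simp]:
  "mat2 a b c d ** mat2 a' b' c' d' =
    mat2 (a * a' + b * c') (a * b' + b * d') (c * a' + d * c') (c * b' + d * (d'::'a::semiring_1))"
  by (simp add: vec_eq_iff forall_2 matrix_matrix_mult_def UNIV_2)

lemma mat2_in_SL [simp]: "mat2 a b c d \<in> carrier SL \<longleftrightarrow> a * d - b * c = 1"
  by (simp add: SL_def det_2)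

lemma one_SL2: "\<one>\<^bsub>SL\<^esub> = mat2 1 0 0 1"
  by (simp add: SL_def mat_1_mat2)

lemma mult_SL: "A \<otimes>\<^bsub>SL\<^esub> B = A ** B"
  by (simp add: SL_def)

lemma inv_SL2:
  assumes "a * d - b * c = (1::'f::field)"
  shows "inv\<^bsub>SL\<^esub> (mat2 a b c d) = mat2 d (- b) (- c) a"
proof (rule group.inv_equality[OF group_SL])
  show "mat2 d (- b) (- c) a \<otimes>\<^bsub>SL\<^esub> mat2 a b c d = \<one>\<^bsub>SL\<^esub>"
    using assms by (simp add: mult_SL one_SL2 mult.commute)
qed (use assms in \<open>simp_all add: mult.commute\<close>)

lemma card_SL2_le:
  assumes "CARD('f::{field,finite}) = 2"
  shows "card (carrier (SL :: ('f ^ 2 ^ 2) monoid)) \<le> 6"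
proof -
  have "card {0, 1::'f} = CARD('f)"
    using assms by simp
  hence "{0, 1::'f} = UNIV"
    by (intro card_subset_eq) simp_all
  hence U: "x = 0 \<or> x = 1" for x :: 'f
    by (metis UNIV_I insertE singletonD)
  let ?S = "{mat2 1 0 0 1, mat2 1 1 0 1, mat2 1 0 1 1, mat2 0 1 1 0, mat2 1 1 1 0, mat2 0 1 1 (1::'f)}"
  have "carrier SL \<subseteq> ?S"
  proof
    fix A :: "'f ^ 2 ^ 2" assume A: "A \<in> carrier SL"
    obtain a b c d where [simp]: "A = mat2 a b c d" by (rule mat2_cases)
    \<comment> \<open>Of the sixteen choices of entries, the determinant condition leaves the six
      listed.\<close>
    show "A \<in> ?S"
      using A U[of a] U[of b] U[of c] U[of d] by (elim disjE) simp_all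
  qed
  hence "card (carrier (SL :: ('f ^ 2 ^ 2) monoid)) \<le> card ?S"
    by (intro card_mono) simp_all
  also have "\<dots> \<le> 6"
    by simp
  finally show ?thesis .
qed

text \<open>A central matrix is scalar, and in characteristic 2 the equation
  \<open>a * a = 1\<close> has the only solution 1.\<close>

lemma center_SL2:
  assumes two: "(1::'f::field) + 1 = 0"
  shows "center (SL :: ('f ^ 2 ^ 2) monoid) = {\<one>\<^bsub>SL\<^esub>}"
proof (intro subset_antisym subsetI)
  fix A :: "'f ^ 2 ^ 2" assume A: "A \<in> center SL"
  obtain a b c d where [simp]: "A = mat2 a b c d" by (rule mat2_cases)
  \<comment> \<open>Commuting with the upper transvection gives \<open>c = 0\<close> and
    \<open>a = d\<close>; the lower one gives \<open>b = 0\<close>.\<close>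
  have "A ** mat2 1 1 0 1 = mat2 1 1 0 1 ** A" "A ** mat2 1 0 1 1 = mat2 1 0 1 1 ** A"
    using A by (simp_all add: center_def mult_SL del: mat2_mult \<open>A = _\<close>)
  hence "b = 0" "c = 0" "d = a" by simp_all
  moreover have "a * d - b * c = 1"
    using A by (simp add: center_def)
  \<comment> \<open>With \<open>a * a = 1\<close> the square expands to 2 - 2a, which vanishes in
    characteristic 2.\<close>
  ultimately have "(a - 1) * (a - 1) = (1 + 1) * (1 - a)"
    by (simp add: algebra_simps)
  hence "a = 1"
    unfolding two by simp
  with \<open>b = 0\<close> \<open>c = 0\<close> \<open>d = a\<close> show "A \<in> {\<one>\<^bsub>SL\<^esub>}"
    by (simp add: one_SL2)
next
  fix A :: "'f ^ 2 ^ 2" assume "A \<in> {\<one>\<^bsub>SL\<^esub>}"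
  thus "A \<in> center SL"
    using group_SL[where ?'f = 'f and ?'n = 2]
    by (simp add: center_def group.is_monoid)
qed

section \<open>Four subgroups of SL(2,q) forming an induced path\<close>

text \<open>The inverse of a matrix of determinant 1 is its adjugate, so closure under inverses
  becomes a condition on entries.\<close>

lemma subgroup_SL2I:
  assumes "S \<subseteq> carrier SL" "mat2 1 0 0 1 \<in> S"
    and "\<And>a b c d. mat2 a b c d \<in> S \<Longrightarrow> mat2 d (- b) (- c) (a::'f::field) \<in> S"
    and "\<And>A B. A \<in> S \<Longrightarrow> B \<in> S \<Longrightarrow> A ** B \<in> S"
  shows "subgroup S SL"
proof (rule group.subgroupI[OF group_SL])
  fix A assume A: "A \<in> S"
  obtain a b c d where [simp]: "A = mat2 a b c d" by (rule mat2_cases)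
  show "inv\<^bsub>SL\<^esub> A \<in> S"
    using A assms(1,3) by (auto simp: inv_SL2)
qed (use assms in \<open>auto simp: mult_SL\<close>)

text \<open>The condition \<open>x \<noteq> 0\<close> makes \<open>X\<close> non-trivial, and
  \<open>x \<noteq> 1\<close> keeps its generator out of \<open>S\<close>.\<close>

lemma SL2_induced_path:
  fixes x :: "'f::field"
  assumes two: "(1::'f) + 1 = 0" and x: "x \<noteq> 0" "x \<noteq> 1"
  defines "U \<equiv> range (\<lambda>t::'f. mat2 1 t 0 1)"
    and "L \<equiv> range (\<lambda>t::'f. mat2 1 0 t 1)"
    and "X \<equiv> {mat2 1 0 0 1, mat2 1 x 0 1}"
    and "S \<equiv> {A \<in> carrier SL. \<forall>i j. A $ i $ j \<in> {0, 1::'f}}"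
  shows "nontrivial_subgroup U SL" "nontrivial_subgroup L SL"
    "nontrivial_subgroup X SL" "nontrivial_subgroup S SL"
    and "U \<inter> L = {\<one>\<^bsub>SL\<^esub>}" "L \<inter> X = {\<one>\<^bsub>SL\<^esub>}" "X \<inter> S = {\<one>\<^bsub>SL\<^esub>}"
    and "U \<inter> X \<noteq> {\<one>\<^bsub>SL\<^esub>}" "U \<inter> S \<noteq> {\<one>\<^bsub>SL\<^esub>}" "L \<inter> S \<noteq> {\<one>\<^bsub>SL\<^esub>}"
proof -
  have dbl: "y + y = 0" for y :: 'f
    using two by (metis distrib_right mult_1 mult_zero_left)
  hence neg: "- y = y" for y :: 'f
    by (metis add.inverse_unique)
  have S: "mat2 a b c d \<in> S \<longleftrightarrow> a * d - b * c = 1 \<and> {a, b, c, d} \<subseteq> {0, 1}" for a b c d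
    by (auto simp: S_def forall_2)
  have in_U: "mat2 1 1 0 1 \<in> U" and in_L: "mat2 1 0 1 1 \<in> L"
    by (auto simp: U_def L_def)
  have in_S: "mat2 1 1 0 1 \<in> S" "mat2 1 0 1 1 \<in> S"
    by (simp_all add: S)
  have "subgroup U SL"
    by (rule subgroup_SL2I) (auto simp: U_def)
  moreover have "subgroup L SL"
    by (rule subgroup_SL2I) (auto simp: L_def)
  \<comment> \<open>Since \<open>x + x = 0\<close>, the generator of \<open>X\<close> is its own
    inverse.\<close>
  moreover have "subgroup X SL"
    by (rule subgroup_SL2I) (auto simp: X_def neg dbl)
  moreover have "subgroup S SL"
  proof (rule subgroup_SL2I)
    fix A B assume AB: "A \<in> S" "B \<in> S"
    obtain a b c d where A: "A = mat2 a b c d" by (rule mat2_cases)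
    obtain a' b' c' d' where B: "B = mat2 a' b' c' d'" by (rule mat2_cases)
    \<comment> \<open>Closure of \<open>SL\<close> supplies the determinant of the product without
      expanding it.\<close>
    have "A \<otimes>\<^bsub>SL\<^esub> B \<in> carrier SL"
      using AB group_SL by (auto simp: S_def intro: monoid.m_closed group.is_monoid)
    hence det: "(a * a' + b * c') * (c * b' + d * d') - (a * b' + b * d') * (c * a' + d * c') = 1"
      unfolding A B mult_SL mat2_mult mat2_in_SL .
    \<comment> \<open>Because 1 + 1 = 0, the set {0, 1} is the prime field, closed under sums and
      products.\<close>
    have closed: "y * z + v * w \<in> {0, 1}"
      if "y \<in> {0, 1}" "z \<in> {0, 1}" "v \<in> {0, 1}" "w \<in> {0, 1}" for y z v w :: 'f
      using that two by auto
    have "a \<in> {0, 1}" "b \<in> {0, 1}" "c \<in> {0, 1}" "d \<in> {0, 1}"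
      "a' \<in> {0, 1}" "b' \<in> {0, 1}" "c' \<in> {0, 1}" "d' \<in> {0, 1}"
      using AB unfolding A B S by simp_all
    hence "{a * a' + b * c', a * b' + b * d', c * a' + d * c', c * b' + d * d'} \<subseteq> {0, 1}"
      by (intro insert_subsetI empty_subsetI closed)
    with det show "A ** B \<in> S"
      unfolding A B mat2_mult S by (rule conjI)
  next
    show "S \<subseteq> carrier SL" by (simp add: S_def)
  qed (auto simp: S neg mult.commute)
  ultimately show "nontrivial_subgroup U SL" "nontrivial_subgroup L SL"
    "nontrivial_subgroup X SL" "nontrivial_subgroup S SL"
    using in_U in_L in_S x unfolding nontrivial_subgroup_def X_def
    by (auto simp: one_SL2)
  show "U \<inter> L = {\<one>\<^bsub>SL\<^esub>}" "L \<inter> X = {\<one>\<^bsub>SL\<^esub>}" "X \<inter> S = {\<one>\<^bsub>SL\<^esub>}"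
    "U \<inter> X \<noteq> {\<one>\<^bsub>SL\<^esub>}"
    using x by (auto simp: U_def L_def X_def S one_SL2)
  show "U \<inter> S \<noteq> {\<one>\<^bsub>SL\<^esub>}" "L \<inter> S \<noteq> {\<one>\<^bsub>SL\<^esub>}"
    using in_U in_L in_S unfolding one_SL2 by (metis IntI mat2_eq_iff singletonD zero_neq_one)+
qed

text \<open>An injective homomorphism preserves which subgroups meet trivially, so the path in
  \<open>SL\<close> is carried over to \<open>G\<close>.\<close>

lemma not_cograph_iso_SL2:
  fixes G :: "('a, 'm) monoid_scheme" and h :: "'f::field ^ 2 ^ 2 \<Rightarrow> 'a"
  assumes "group G" and h: "h \<in> iso SL G"
    and two: "(1::'f) + 1 = 0" and x: "x \<noteq> 0" "x \<noteq> (1::'f)"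
  shows "\<not> cograph (with_proj (intersection_subgroup_graph G))"
proof -
  note path = SL2_induced_path[OF two x]
  have one: "h ` {\<one>\<^bsub>SL\<^esub>} = {\<one>\<^bsub>G\<^esub>}"
    using h \<open>group G\<close> group_SL by (auto simp: iso_def intro: hom_one)
  have img: "h ` A \<inter> h ` B = {\<one>\<^bsub>G\<^esub>} \<longleftrightarrow> A \<inter> B = {\<one>\<^bsub>SL\<^esub>}"
    if "nontrivial_subgroup A SL" "nontrivial_subgroup B SL" for A B
  proof -
    have sub: "A \<subseteq> carrier SL" "B \<subseteq> carrier SL"
      using that by (auto simp: nontrivial_subgroup_def dest: subgroup.subset)
    have inj: "inj_on h (carrier SL)"
      using h by (simp add: iso_iff)
    have "h ` A \<inter> h ` B = h ` (A \<inter> B)"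
      using inj_on_image_Int[OF inj sub] by simp
    moreover have "{\<one>\<^bsub>SL\<^esub>} \<subseteq> carrier (SL :: ('f ^ 2 ^ 2) monoid)"
      by (simp add: one_SL2)
    ultimately show ?thesis
      using inj_on_image_eq_iff[OF inj, of "A \<inter> B" "{\<one>\<^bsub>SL\<^esub>}"] sub one by auto
  qed
  show ?thesis
    by (rule group.not_cograph_intersection_subgroup_graph[OF \<open>group G\<close>
          path(1-4)[THEN nontrivial_subgroup_iso_image[OF group_SL \<open>group G\<close> h]]])
      (simp_all only: img path simp_thms)
qed

theorem theorem8p3:
  fixes G :: "('a, 'm) monoid_scheme" and q :: nat
  assumes "group G"
    and "CARD('f::{field,finite}) = q" and "even q"
    and "G \<cong> (PSL :: ('f ^ 2 ^ 2) set monoid)"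
  shows "cograph (with_proj (intersection_subgroup_graph G)) \<longleftrightarrow> q = 2"
proof
  have two: "(1::'f) + 1 = 0"
    using assms(2,3) by (intro even_card_imp_char_2) simp
  let ?SL = "SL :: ('f ^ 2 ^ 2) monoid"
  \<comment> \<open>Dividing by the trivial centre does not change the group up to
    isomorphism.\<close>
  have "(PSL :: ('f ^ 2 ^ 2) set monoid) \<cong> ?SL"
    using is_isoI[OF group.trivial_factor_iso[OF group_SL]]
    by (simp add: PSL_def center_SL2[OF two])
  with assms(4) have G_SL: "G \<cong> ?SL"
    by (rule iso_trans)
  {
    assume cog: "cograph (with_proj (intersection_subgroup_graph G))"
    obtain h where h: "h \<in> iso ?SL G"
      using group.iso_sym[OF assms(1) G_SL] by (auto simp: is_iso_def)
    \<comment> \<open>Any other field element would serve as the corner entry of the generator of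
      \<open>X\<close> and give an induced path.\<close>
    have "x \<in> {0, 1}" for x :: 'f
      using not_cograph_iso_SL2[OF assms(1) h two] cog by blast
    hence "(UNIV :: 'f set) = {0, 1}" by blast
    hence "CARD('f) = card {0, 1::'f}"
      by (rule arg_cong)
    thus "q = 2"
      by (simp add: assms(2))
  }
  assume "q = 2"
  hence "order G \<le> 6"
    using card_SL2_le[where ?'f = 'f] iso_same_card[OF G_SL] assms(2) by (simp add: order_def)
  moreover have "finite (carrier G)"
    using iso_finite[OF G_SL] by simp
  ultimately show "cograph (with_proj (intersection_subgroup_graph G))"
    by (intro group.cograph_intersection_subgroup_graph_small assms(1))
qed

end
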